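(* Let $n\ge 2$. Involutions in $G_n$ are conjugate in $G_n$ if and only if they have the same labelled cycle type. In particular, every involution of $G_n$ is conjugate to exactly one element $a=a_{m,k_e,k_o,l}$ (where $m,k_e,k_o,l$ are non-negative integers with $2m+k_e+k_o+l=n$) of the form $$a=\overset{\overset{0}{+}}{(1\;2)}\cdots\overset{\overset{0}{+}}{(2m-1\;\;2m)}\;\overset{\overset{0}{-}}{(2m+1)}\cdots\overset{\overset{0}{-}}{(2m+k_e)}\;\overset{\overset{1}{-}}{(2m+k_e+1)}\cdots\overset{\overset{1}{-}}{(n-l)}\;\overset{\overset{0}{+}}{(n-l+1)}\cdots\overset{\overset{0}{+}}{(n)}.$$
   Context: For $n\ge 2$, let $W_n$ be the Coxeter (Weyl) group of type $C_n$, i.e. the group of signed permutations acting (on the right) on $\mathbb{R}^n$ by permuting the subscripts of the standard basis vectors $e_1,\dots,e_n$ and changing their signs; write $i^{\sigma}=\pm j$ when $e_i^{\sigma}=\pm e_j$. $G_n$ is the affine Weyl group of type $\tilde C_n$, the semidirect product of $W_n$ with $\mathbb{Z}^n$: its elements are pairs $(\sigma,\mathbf v)$ with $\sigma\in W_n$, $\mathbf v=(v_1,\dots,v_n)\in\mathbb{Z}^n$, and the product is $(\alpha,\mathbf v)(\tau,\mathbf u)=(\alpha\tau,\mathbf v^{\tau}+\mathbf u)$. An involution is an element of order exactly 2. Labelled cycle notation for an involution $(\sigma,\mathbf v)$: it is written as a product of disjoint labelled cycles, where $\overset{\overset{\lambda}{+}}{(a\;b)}$ means $a^\sigma=b$,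 $b^\sigma=a$, $v_a=\lambda$, $v_b=-\lambda$; $\overset{\overset{\lambda}{-}}{(a\;b)}$ means $a^\sigma=-b$, $b^\sigma=-a$, $v_a=v_b=\lambda$; $\overset{\overset{\lambda}{-}}{(a)}$ (a negative 1-cycle) means $a^\sigma=-a$, $v_a=\lambda$; and $\overset{\overset{0}{+}}{(a)}$ (a positive 1-cycle) means $a^\sigma=a$, $v_a=0$. Every involution of $G_n$ has such an expression. The labelled cycle type of an involution is $(m,k_e,k_o,l)$, where $m$ is the number of transpositions, $k_e$ the number of negative 1-cycles with even label, $k_o$ the number of negative 1-cycles with odd label, and $l$ the number of positive 1-cycles. *)

theory Defs
  imports "HOL-Algebra.Multiplicative_Group" "HOL-Combinatorics.Permutations"
begin

text \<open>
  A signed permutation \<open>\<sigma>\<close> of \<open>{1..n}\<close> is encoded as an odd permutation function of the nonzero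
  integers \<open>k\<close> with \<open>\<bar>k\<bar> \<le> n\<close>: the integer \<open>-j\<close> stands for \<open>-e_j\<close>, so that \<open>\<sigma> i = j\<close> and
  \<open>\<sigma> i = -j\<close> mean that \<open>\<sigma>\<close> sends \<open>e_i\<close> to \<open>e_j\<close> and to \<open>-e_j\<close> respectively.
\<close>

definition signed_perms :: "nat \<Rightarrow> (int \<Rightarrow> int) set" where
  "signed_perms n =
     {\<sigma>. \<sigma> permutes {k. 1 \<le> \<bar>k\<bar> \<and> \<bar>k\<bar> \<le> int n} \<and> (\<forall>k. \<sigma> (- k) = - \<sigma> k)}"

text \<open>Elements of \<open>\<int>\<^sup>n\<close> are integer-valued functions vanishing outside \<open>{1..n}\<close>.\<close>

definition int_vecs :: "nat \<Rightarrow> (int \<Rightarrow> int) set" where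
  "int_vecs n = {v. \<forall>i. i \<notin> {1..int n} \<longrightarrow> v i = 0}"

text \<open>\<open>signed_basis j\<close> is \<open>e_j\<close> and \<open>signed_basis (-j)\<close> is \<open>-e_j\<close>, for \<open>j > 0\<close>.\<close>

definition signed_basis :: "int \<Rightarrow> int \<Rightarrow> int" where
  "signed_basis k = (\<lambda>j. if j = \<bar>k\<bar> then sgn k else 0)"

definition vec_act :: "nat \<Rightarrow> (int \<Rightarrow> int) \<Rightarrow> (int \<Rightarrow> int) \<Rightarrow> (int \<Rightarrow> int)" where
  "vec_act n v \<sigma> = (\<lambda>j. \<Sum>i\<in>{1..int n}. v i * signed_basis (\<sigma> i) j)"

text \<open>
  The action is on the right, so the product of \<open>\<alpha>\<close> and \<open>\<tau>\<close> (first \<open>\<alpha>\<close>, then \<open>\<tau>\<close>) is \<open>\<tau> \<circ> \<alpha>\<close>.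
\<close>

definition affine_C :: "nat \<Rightarrow> ((int \<Rightarrow> int) \<times> (int \<Rightarrow> int)) monoid" where
  "affine_C n =
     \<lparr>carrier = signed_perms n \<times> int_vecs n,
      monoid.mult = (\<lambda>(\<alpha>, v) (\<tau>, u). (\<tau> \<circ> \<alpha>, \<lambda>j. vec_act n v \<tau> j + u j)),
      monoid.one = (id, \<lambda>_. 0)\<rparr>"

definition is_involution :: "('a, 'b) monoid_scheme \<Rightarrow> 'a \<Rightarrow> bool" where
  "is_involution G x \<longleftrightarrow> x \<in> carrier G \<and> group.ord G x = 2"

definition conjugate_in :: "('a, 'b) monoid_scheme \<Rightarrow> 'a \<Rightarrow> 'a \<Rightarrow> bool" where
  "conjugate_in G x y \<longleftrightarrow>
     x \<in> carrier G \<and> y \<in> carrier G \<and>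
     (\<exists>g\<in>carrier G. y = inv\<^bsub>G\<^esub> g \<otimes>\<^bsub>G\<^esub> x \<otimes>\<^bsub>G\<^esub> g)"

definition pos_transposition :: "(int \<Rightarrow> int) \<times> (int \<Rightarrow> int) \<Rightarrow> int \<Rightarrow> int \<Rightarrow> int \<Rightarrow> bool" where
  "pos_transposition x a b c \<longleftrightarrow>
     a \<noteq> b \<and> fst x a = b \<and> fst x b = a \<and> snd x a = c \<and> snd x b = - c"

definition neg_transposition :: "(int \<Rightarrow> int) \<times> (int \<Rightarrow> int) \<Rightarrow> int \<Rightarrow> int \<Rightarrow> int \<Rightarrow> bool" where
  "neg_transposition x a b c \<longleftrightarrow>
     a \<noteq> b \<and> fst x a = - b \<and> fst x b = - a \<and> snd x a = c \<and> snd x b = c"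

definition neg_1cycle :: "(int \<Rightarrow> int) \<times> (int \<Rightarrow> int) \<Rightarrow> int \<Rightarrow> int \<Rightarrow> bool" where
  "neg_1cycle x a c \<longleftrightarrow> fst x a = - a \<and> snd x a = c"

definition pos_1cycle :: "(int \<Rightarrow> int) \<times> (int \<Rightarrow> int) \<Rightarrow> int \<Rightarrow> bool" where
  "pos_1cycle x a \<longleftrightarrow> fst x a = a \<and> snd x a = 0"

text \<open>
  The tuple \<open>(m, k_e, k_o, l)\<close>.  A transposition is identified with its underlying unordered pair;
  both signs of transposition contribute to \<open>m\<close>.
\<close>

definition labelled_cycle_type ::
    "nat \<Rightarrow> (int \<Rightarrow> int) \<times> (int \<Rightarrow> int) \<Rightarrow> nat \<times> nat \<times> nat \<times> nat" where
  "labelled_cycle_type n x =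
     (card {{a, b} | a b. a \<in> {1..int n} \<and> b \<in> {1..int n} \<and>
              (\<exists>c. pos_transposition x a b c \<or> neg_transposition x a b c)},
      card {a \<in> {1..int n}. \<exists>c. neg_1cycle x a c \<and> even c},
      card {a \<in> {1..int n}. \<exists>c. neg_1cycle x a c \<and> odd c},
      card {a \<in> {1..int n}. pos_1cycle x a})"

text \<open>
  The element \<open>a_{m,k_e,k_o,l}\<close>, for \<open>2 * m + k_e + k_o + l = n\<close>; its labelled cycles are
  spelled out in the lemma \<open>standard_elt_cycles\<close> below.
\<close>

definition standard_elt ::
    "nat \<Rightarrow> nat \<Rightarrow> nat \<Rightarrow> nat \<Rightarrow> nat \<Rightarrow> (int \<Rightarrow> int) \<times> (int \<Rightarrow> int)" where
  "standard_elt n m ke ko l =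
     (\<lambda>i. if \<bar>i\<bar> \<le> 2 * int m then sgn i * (if odd i then \<bar>i\<bar> + 1 else \<bar>i\<bar> - 1)
          else if \<bar>i\<bar> \<le> int n - int l then - i
          else i,
      \<lambda>i. if 2 * int m + int ke + 1 \<le> i \<and> i \<le> int n - int l then 1 else 0)"

lemma standard_elt_cycles:
  assumes "2 * m + ke + ko + l = n"
  defines "x \<equiv> standard_elt n m ke ko l"
  shows "i \<in> {1..int m} \<Longrightarrow> pos_transposition x (2 * i - 1) (2 * i) 0"
    and "i \<in> {2 * int m + 1..2 * int m + int ke} \<Longrightarrow> neg_1cycle x i 0"
    and "i \<in> {2 * int m + int ke + 1..int n - int l} \<Longrightarrow> neg_1cycle x i 1"
    and "i \<in> {int n - int l + 1..int n} \<Longrightarrow> pos_1cycle x i"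
  using assms
  by (auto simp: standard_elt_def pos_transposition_def neg_1cycle_def pos_1cycle_def)

lemma signed_permsD:
  assumes "\<sigma> \<in> signed_perms n"
  shows "\<sigma> permutes {k. 1 \<le> \<bar>k\<bar> \<and> \<bar>k\<bar> \<le> int n}" "\<sigma> (- k) = - \<sigma> k"
    "i \<in> {1..int n} \<Longrightarrow> 1 \<le> \<bar>\<sigma> i\<bar> \<and> \<bar>\<sigma> i\<bar> \<le> int n"
proof -
  show *: "\<sigma> permutes {k. 1 \<le> \<bar>k\<bar> \<and> \<bar>k\<bar> \<le> int n}" "\<sigma> (- k) = - \<sigma> k"
    using assms by (auto simp: signed_perms_def)
  show "1 \<le> \<bar>\<sigma> i\<bar> \<and> \<bar>\<sigma> i\<bar> \<le> int n" if "i \<in> {1..int n}"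
    using permutes_in_image[OF *(1), of i] that by auto
qed

lemma standard_elt_in_carrier:
  assumes "2 * m + ke + ko + l = n"
  shows "standard_elt n m ke ko l \<in> carrier (affine_C n)"
proof -
  let ?s = "fst (standard_elt n m ke ko l)"
  have invol: "?s (?s i) = i" for i
    by (auto simp: standard_elt_def sgn_if abs_if; presburger)
  have "?s permutes {k. 1 \<le> \<bar>k\<bar> \<and> \<bar>k\<bar> \<le> int n}"
  proof (rule bij_imp_permutes)
    have im: "?s ` {k. 1 \<le> \<bar>k\<bar> \<and> \<bar>k\<bar> \<le> int n} \<subseteq> {k. 1 \<le> \<bar>k\<bar> \<and> \<bar>k\<bar> \<le> int n}"
      using assms by (auto simp: standard_elt_def sgn_if abs_if; presburger)
    then show "bij_betw ?s {k. 1 \<le> \<bar>k\<bar> \<and> \<bar>k\<bar> \<le> int n} {k. 1 \<le> \<bar>k\<bar> \<and> \<bar>k\<bar> \<le> int n}"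
      using invol by (intro bij_betw_byWitness[where f' = ?s]) auto
  next
    fix i assume "i \<notin> {k. 1 \<le> \<bar>k\<bar> \<and> \<bar>k\<bar> \<le> int n}"
    then show "?s i = i"
      using assms by (auto simp: standard_elt_def sgn_if abs_if)
  qed
  moreover have "?s (- k) = - ?s k" for k
    by (auto simp: standard_elt_def sgn_if)
  ultimately show ?thesis
    using assms by (auto simp: affine_C_def signed_perms_def int_vecs_def standard_elt_def)
qed

lemma vec_act_signed_basis:
  assumes "\<tau> \<in> signed_perms n" "1 \<le> \<bar>k\<bar>" "\<bar>k\<bar> \<le> int n"
  shows "vec_act n (signed_basis k) \<tau> = signed_basis (\<tau> k)"
proof
  fix j
  have "vec_act n (signed_basis k) \<tau> j
      = (\<Sum>i\<in>{1..int n}. if i = \<bar>k\<bar> then sgn k * signed_basis (\<tau> i) j else 0)"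
    unfolding vec_act_def by (intro sum.cong) (auto simp: signed_basis_def)
  also have "\<dots> = sgn k * signed_basis (\<tau> \<bar>k\<bar>) j"
    using assms by (simp add: sum.delta)
  also have "\<dots> = signed_basis (\<tau> k) j"
    using assms signed_permsD(2)[OF assms(1), of k]
    by (cases "k \<ge> 0") (auto simp: signed_basis_def sgn_if)
  finally show "vec_act n (signed_basis k) \<tau> j = signed_basis (\<tau> k) j" .
qed

lemma vec_act_comp:
  assumes "\<alpha> \<in> signed_perms n" "\<tau> \<in> signed_perms n"
  shows "vec_act n (vec_act n v \<alpha>) \<tau> = vec_act n v (\<tau> \<circ> \<alpha>)"
proof
  fix j
  have "vec_act n (vec_act n v \<alpha>) \<tau> j
      = (\<Sum>i\<in>{1..int n}. \<Sum>k\<in>{1..int n}. v k * (signed_basis (\<alpha> k) i * signed_basis (\<tau> i) j))"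
    by (simp add: vec_act_def sum_distrib_right mult.assoc)
  also have "\<dots> = (\<Sum>k\<in>{1..int n}. v k * vec_act n (signed_basis (\<alpha> k)) \<tau> j)"
    by (subst sum.swap) (simp add: vec_act_def sum_distrib_left)
  also have "\<dots> = (\<Sum>k\<in>{1..int n}. v k * signed_basis (\<tau> (\<alpha> k)) j)"
    using signed_permsD(3)[OF assms(1)]
    by (intro sum.cong) (simp_all add: vec_act_signed_basis[OF assms(2)])
  finally show "vec_act n (vec_act n v \<alpha>) \<tau> j = vec_act n v (\<tau> \<circ> \<alpha>) j"
    by (simp add: vec_act_def)
qed

lemma vec_act_add: "vec_act n (\<lambda>i. v i + w i) \<tau> = (\<lambda>j. vec_act n v \<tau> j + vec_act n w \<tau> j)"
  by (simp add: vec_act_def distrib_right sum.distrib)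

lemma vec_act_id:
  assumes "v \<in> int_vecs n"
  shows "vec_act n v id = v"
proof
  fix j
  have "vec_act n v id j = (\<Sum>i\<in>{1..int n}. if i = j then v i else 0)"
    unfolding vec_act_def by (intro sum.cong) (auto simp: signed_basis_def)
  also have "\<dots> = v j"
    using assms by (auto simp: int_vecs_def)
  finally show "vec_act n v id j = v j" .
qed

lemma vec_act_in_int_vecs:
  assumes "\<tau> \<in> signed_perms n"
  shows "vec_act n v \<tau> \<in> int_vecs n"
  unfolding int_vecs_def vec_act_def
  using signed_permsD(3)[OF assms] by (force simp: signed_basis_def intro!: sum.neutral)

lemma signed_perms_comp:
  "\<alpha> \<in> signed_perms n \<Longrightarrow> \<tau> \<in> signed_perms n \<Longrightarrow> \<tau> \<circ> \<alpha> \<in> signed_perms n"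
  by (auto simp: signed_perms_def intro: permutes_compose)

lemma signed_perms_inv:
  assumes "\<alpha> \<in> signed_perms n"
  shows "Hilbert_Choice.inv \<alpha> \<in> signed_perms n"
proof -
  note p = signed_permsD(1)[OF assms]
  have "Hilbert_Choice.inv \<alpha> (- k) = - Hilbert_Choice.inv \<alpha> k" for k
    using permutes_inv_eq[OF p] signed_permsD(2)[OF assms] permutes_inverses[OF p] by simp
  then show ?thesis
    using permutes_inv[OF p] by (simp add: signed_perms_def)
qed

lemma affine_C_group: "group (affine_C n)"
proof (rule groupI)
  fix x y assume "x \<in> carrier (affine_C n)" "y \<in> carrier (affine_C n)"
  then show "x \<otimes>\<^bsub>affine_C n\<^esub> y \<in> carrier (affine_C n)"
    using vec_act_in_int_vecs[of _ n] signed_perms_comp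
    by (fastforce simp: affine_C_def int_vecs_def)
next
  show "\<one>\<^bsub>affine_C n\<^esub> \<in> carrier (affine_C n)"
    by (auto simp: affine_C_def signed_perms_def int_vecs_def permutes_id)
next
  fix x y z
  assume "x \<in> carrier (affine_C n)" "y \<in> carrier (affine_C n)" "z \<in> carrier (affine_C n)"
  then show "x \<otimes>\<^bsub>affine_C n\<^esub> y \<otimes>\<^bsub>affine_C n\<^esub> z = x \<otimes>\<^bsub>affine_C n\<^esub> (y \<otimes>\<^bsub>affine_C n\<^esub> z)"
    by (auto simp: affine_C_def vec_act_add vec_act_comp)
next
  fix x assume "x \<in> carrier (affine_C n)"
  then show "\<one>\<^bsub>affine_C n\<^esub> \<otimes>\<^bsub>affine_C n\<^esub> x = x"
    by (auto simp: affine_C_def vec_act_def)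
next
  fix x assume x: "x \<in> carrier (affine_C n)"
  obtain \<sigma> v where xe: "x = (\<sigma>, v)" and s: "\<sigma> \<in> signed_perms n" and v: "v \<in> int_vecs n"
    using x by (auto simp: affine_C_def)
  let ?t = "Hilbert_Choice.inv \<sigma>"
  have t: "?t \<in> signed_perms n"
    using signed_perms_inv[OF s] .
  let ?y = "(?t, \<lambda>j. - vec_act n v ?t j)"
  have "\<sigma> \<circ> ?t = id"
    using permutes_inv_o(1)[OF signed_permsD(1)[OF s]] .
  moreover have "vec_act n (\<lambda>j. - vec_act n v ?t j) \<sigma> = (\<lambda>j. - vec_act n (vec_act n v ?t) \<sigma> j)"
    by (simp add: vec_act_def sum_negf)
  ultimately have "?y \<otimes>\<^bsub>affine_C n\<^esub> x = \<one>\<^bsub>affine_C n\<^esub>"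
    using vec_act_comp[OF t s, of v] vec_act_id[OF v]
    by (simp add: affine_C_def xe)
  moreover have "?y \<in> carrier (affine_C n)"
    using t vec_act_in_int_vecs[OF t, of v] by (auto simp: affine_C_def int_vecs_def)
  ultimately show "\<exists>y\<in>carrier (affine_C n). y \<otimes>\<^bsub>affine_C n\<^esub> x = \<one>\<^bsub>affine_C n\<^esub>"
    by blast
qed

end

theory Submission
  imports Defs
begin

text \<open>
  Extend \<open>v \<in> \<int>\<^sup>n\<close> to an odd function \<open>V\<close> on the integers, so that \<open>V (-i) = - V i\<close>. The action then
  becomes relabelling, \<open>V\<^sup>\<tau> (\<tau> k) = V k\<close>, and conjugating an involution \<open>(\<sigma>, v)\<close> by a pair given by
  \<open>\<tau>\<close> and a translation \<open>T\<close> yields \<open>(\<rho>, w)\<close> with \<open>\<rho> = \<tau>\<sigma>\<tau>\<^sup>-\<^sup>1\<close> and \<open>W (\<tau> k) = V k + T k - T (\<sigma> k)\<close>.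
  If \<open>\<sigma> k = -k\<close> the label changes by \<open>2 T k\<close>, so its parity is invariant and is all that survives;
  on a transposition the label can be cancelled completely. A negative transposition becomes positive
  when \<open>\<tau>\<close> maps \<open>2i-1\<close> to \<open>a\<close> and \<open>2i\<close> to the signed image \<open>\<sigma> a\<close>.
\<close>

section \<open>Odd extensions and the action of signed permutations\<close>

definition odd_ext :: "(int \<Rightarrow> int) \<Rightarrow> int \<Rightarrow> int" where
  "odd_ext v k = sgn k * v \<bar>k\<bar>"

lemma odd_ext_0 [simp]: "odd_ext v 0 = 0"
  by (simp add: odd_ext_def)

lemma odd_ext_pos: "0 < k \<Longrightarrow> odd_ext v k = v k"
  by (simp add: odd_ext_def)

lemma odd_ext_minus [simp]: "odd_ext v (- k) = - odd_ext v k"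
  by (simp add: odd_ext_def sgn_minus)

lemma odd_ext_add: "odd_ext (\<lambda>j. v j + w j) k = odd_ext v k + odd_ext w k"
  by (simp add: odd_ext_def distrib_left)

lemma int_vecs_eqI:
  assumes "v \<in> int_vecs n" "w \<in> int_vecs n" "\<And>k. odd_ext v k = odd_ext w k"
  shows "v = w"
proof
  fix j
  show "v j = w j"
    using assms(1,2) assms(3)[of j] by (cases "j > 0") (auto simp: int_vecs_def odd_ext_pos)
qed

lemma signed_perms_0: "\<sigma> \<in> signed_perms n \<Longrightarrow> \<sigma> 0 = 0"
  using signed_permsD(2)[of \<sigma> n 0] by simp

lemma signed_perms_outside: "\<sigma> \<in> signed_perms n \<Longrightarrow> \<not> \<bar>k\<bar> \<le> int n \<Longrightarrow> \<sigma> k = k"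
  by (rule permutes_not_in[OF signed_permsD(1)]) auto

lemma signed_perms_inj: "\<sigma> \<in> signed_perms n \<Longrightarrow> \<sigma> j = \<sigma> k \<longleftrightarrow> j = k"
  by (meson signed_permsD(1) permutes_inj injD)

lemma signed_perms_abs_in:
  "\<sigma> \<in> signed_perms n \<Longrightarrow> i \<in> {1..int n} \<Longrightarrow> \<bar>\<sigma> i\<bar> \<in> {1..int n}"
  using signed_permsD(3)[of \<sigma> n i] by auto

lemma signed_perms_abs:
  assumes "\<sigma> \<in> signed_perms n"
  shows "\<sigma> \<bar>k\<bar> = (if k < 0 then - \<sigma> k else \<sigma> k)"
  using signed_permsD(2)[OF assms, of k] by (auto simp: abs_if)

text \<open>For \<open>0 < k \<le> n\<close> only the summand \<open>i = k\<close> contributes to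
  the coordinate \<open>\<bar>\<tau> k\<bar>\<close>, since
  \<open>\<bar>\<tau> i\<bar> = \<bar>\<tau> k\<bar>\<close> forces \<open>i = k\<close> or
  \<open>i = - k\<close>. Its sign cancels against the sign in \<open>odd_ext\<close>.\<close>

lemma odd_ext_vec_act:
  assumes \<tau>: "\<tau> \<in> signed_perms n" and v: "v \<in> int_vecs n"
  shows "odd_ext (vec_act n v \<tau>) (\<tau> k) = odd_ext v k"
proof -
  have pos: "odd_ext (vec_act n v \<tau>) (\<tau> k) = odd_ext v k" if k: "k > 0" for k
  proof (cases "k \<le> int n")
    case True
    have eq: "\<bar>\<tau> k\<bar> = \<bar>\<tau> i\<bar> \<longleftrightarrow> i = k" if "i \<in> {1..int n}" for i
      using that k signed_perms_inj[OF \<tau>, of i k] signed_perms_inj[OF \<tau>, of i "-k"]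
        signed_permsD(2)[OF \<tau>, of k] by (auto simp: abs_eq_iff)
    have nz: "\<tau> k \<noteq> 0"
      using signed_permsD(3)[OF \<tau>, of k] k True by auto
    have "vec_act n v \<tau> \<bar>\<tau> k\<bar> = (\<Sum>i\<in>{1..int n}. if i = k then v k * sgn (\<tau> k) else 0)"
      unfolding vec_act_def signed_basis_def by (intro sum.cong) (auto simp: eq)
    also have "\<dots> = v k * sgn (\<tau> k)"
      using k True by (simp add: sum.delta)
    finally show ?thesis
      using k nz by (simp add: odd_ext_def sgn_if)
  next
    case False
    have "vec_act n v \<tau> k = 0" "v k = 0"
      using vec_act_in_int_vecs[OF \<tau>, of v] v False by (auto simp: int_vecs_def)
    then show ?thesis
      using signed_perms_outside[OF \<tau>, of k] False k by (simp add: odd_ext_pos)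
  qed
  show ?thesis
    using pos[of k] pos[of "- k"] signed_permsD(2)[OF \<tau>, of k] signed_perms_0[OF \<tau>]
    by (cases k "0 :: int" rule: linorder_cases) auto
qed

section \<open>Conjugacy in the affine group\<close>

lemma carrier_affine_C:
  "x \<in> carrier (affine_C n) \<longleftrightarrow> fst x \<in> signed_perms n \<and> snd x \<in> int_vecs n"
  by (cases x) (simp add: affine_C_def)

lemma mult_affine_C:
  "(\<alpha>, v) \<otimes>\<^bsub>affine_C n\<^esub> (\<tau>, u) = (\<tau> \<circ> \<alpha>, \<lambda>j. vec_act n v \<tau> j + u j)"
  by (simp add: affine_C_def)

text \<open>Multiplying by \<open>g\<close> removes the inverse and leaves two products that can be
  compared componentwise.\<close>

lemma (in group) conjugate_in_iff:
  assumes "x \<in> carrier G" "y \<in> carrier G"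
  shows "conjugate_in G x y \<longleftrightarrow> (\<exists>g\<in>carrier G. x \<otimes> g = g \<otimes> y)"
  using assms unfolding conjugate_in_def by (metis inv_closed inv_solve_left m_assoc m_closed)

lemma (in group) conjugate_in_sym:
  assumes "conjugate_in G x y"
  shows "conjugate_in G y x"
proof -
  obtain g where g: "g \<in> carrier G" "x \<otimes> g = g \<otimes> y" and xy: "x \<in> carrier G" "y \<in> carrier G"
    using assms conjugate_in_iff by (auto simp: conjugate_in_def)
  have "y \<otimes> inv g = inv g \<otimes> x"
    using g xy by (metis inv_closed inv_solve_left inv_solve_right m_assoc m_closed)
  then show ?thesis
    using g xy conjugate_in_iff by blast
qed

lemma (in group) conjugate_in_trans:
  assumes "conjugate_in G x y" "conjugate_in G y z"
  shows "conjugate_in G x z"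
proof -
  have c: "x \<in> carrier G" "y \<in> carrier G" "z \<in> carrier G"
    using assms by (auto simp: conjugate_in_def)
  obtain g where g: "g \<in> carrier G" "x \<otimes> g = g \<otimes> y"
    using assms(1) conjugate_in_iff[OF c(1,2)] by blast
  obtain h where h: "h \<in> carrier G" "y \<otimes> h = h \<otimes> z"
    using assms(2) conjugate_in_iff[OF c(2,3)] by blast
  have "x \<otimes> (g \<otimes> h) = g \<otimes> (y \<otimes> h)"
    using g h(1) c by (simp flip: m_assoc)
  also have "\<dots> = (g \<otimes> h) \<otimes> z"
    using g(1) h c by (simp add: m_assoc)
  finally show ?thesis
    using g(1) h(1) conjugate_in_iff[OF c(1,3)] by blast
qed

text \<open>The conjugating element is written as \<open>(\<tau>, t^\<tau>)\<close>, the translation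
  by \<open>t\<close> followed by \<tau>, so that \<open>t\<close> is indexed by the original
  \<open>k\<close> instead of \<open>\<tau> k\<close>. The label equation is the second component of
  \<open>x g = g y\<close>, read off at
  \<open>\<tau> (\<sigma> k) = \<rho> (\<tau> k)\<close>.\<close>

lemma conjugate_affine_C_iff:
  assumes \<sigma>: "\<sigma> \<in> signed_perms n" and v: "v \<in> int_vecs n"
    and \<rho>: "\<rho> \<in> signed_perms n" and w: "w \<in> int_vecs n"
  shows "conjugate_in (affine_C n) (\<sigma>, v) (\<rho>, w) \<longleftrightarrow>
    (\<exists>\<tau>\<in>signed_perms n. \<exists>t\<in>int_vecs n. \<forall>k. \<tau> (\<sigma> k) = \<rho> (\<tau> k) \<and>
       odd_ext w (\<tau> (\<sigma> k)) + odd_ext t k = odd_ext v (\<sigma> k) + odd_ext t (\<sigma> k))"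
    (is "_ \<longleftrightarrow> (\<exists>\<tau>\<in>_. \<exists>t\<in>_. ?R \<tau> t)")
proof -
  interpret group "affine_C n"
    by (rule affine_C_group)
  have commute_iff: "(\<sigma>, v) \<otimes>\<^bsub>affine_C n\<^esub> (\<tau>, vec_act n t \<tau>) = (\<tau>, vec_act n t \<tau>) \<otimes>\<^bsub>affine_C n\<^esub> (\<rho>, w)
      \<longleftrightarrow> ?R \<tau> t" (is "?L \<longleftrightarrow> _") if \<tau>: "\<tau> \<in> signed_perms n" and t: "t \<in> int_vecs n" for \<tau> t
  proof -
    let ?u = "vec_act n t \<tau>"
    let ?p = "\<lambda>j. vec_act n v \<tau> j + ?u j" and ?q = "\<lambda>j. vec_act n ?u \<rho> j + w j"
    have u: "?u \<in> int_vecs n"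
      by (rule vec_act_in_int_vecs[OF \<tau>])
    have pq: "?p \<in> int_vecs n" "?q \<in> int_vecs n"
      using u w vec_act_in_int_vecs[OF \<tau>, of v] vec_act_in_int_vecs[OF \<rho>, of ?u]
      by (auto simp: int_vecs_def)
    have p: "odd_ext ?p (\<tau> (\<sigma> k)) = odd_ext v (\<sigma> k) + odd_ext t (\<sigma> k)" for k
      by (simp add: odd_ext_add odd_ext_vec_act \<tau> v t)
    have q: "odd_ext ?q (\<rho> (\<tau> k)) = odd_ext t k + odd_ext w (\<rho> (\<tau> k))" for k
      by (simp add: odd_ext_add odd_ext_vec_act \<tau> \<rho> u t)
    have "?L \<longleftrightarrow> \<tau> \<circ> \<sigma> = \<rho> \<circ> \<tau> \<and> ?p = ?q"
      by (simp add: mult_affine_C)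
    also have "\<dots> \<longleftrightarrow> ?R \<tau> t"
    proof
      assume "\<tau> \<circ> \<sigma> = \<rho> \<circ> \<tau> \<and> ?p = ?q"
      then have eq: "\<tau> (\<sigma> k) = \<rho> (\<tau> k)" "?p = ?q" for k
        by (auto simp: fun_eq_iff)
      show "?R \<tau> t"
        using p q eq by (metis add.commute)
    next
      assume R: "?R \<tau> t"
      have "odd_ext ?p k = odd_ext ?q k" for k
      proof -
        \<comment> \<open>The labels are known at the points \<open>\<tau> (\<sigma> k')\<close>; by
          surjectivity these are all points.\<close>
        obtain k' where "k = \<tau> (\<sigma> k')"
          using permutes_surj[OF signed_permsD(1)[OF \<tau>]] permutes_surj[OF signed_permsD(1)[OF \<sigma>]]
          by (metis surjD)
        then show ?thesis
          using p[of k'] q[of k'] R[rule_format, of k'] by (metis add.commute)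
      qed
      then show "\<tau> \<circ> \<sigma> = \<rho> \<circ> \<tau> \<and> ?p = ?q"
        using int_vecs_eqI[OF pq] R by (auto simp: fun_eq_iff)
    qed
    finally show ?thesis .
  qed
  have carr: "(\<sigma>, v) \<in> carrier (affine_C n)" "(\<rho>, w) \<in> carrier (affine_C n)"
    using assms by (simp_all add: carrier_affine_C)
  \<comment> \<open>Every vector has the form \<open>t^\<tau>\<close>, with \<open>t\<close> its
    image under the inverse of \<tau>, so the pairs \<open>(\<tau>, t^\<tau>)\<close> exhaust the
    group.\<close>
  have "\<exists>t\<in>int_vecs n. u = vec_act n t \<tau>" if "\<tau> \<in> signed_perms n" "u \<in> int_vecs n" for \<tau> u
  proof
    have "\<tau> \<circ> Hilbert_Choice.inv \<tau> = id"
      using permutes_inv_o(1)[OF signed_permsD(1)[OF that(1)]] .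
    then show "u = vec_act n (vec_act n u (Hilbert_Choice.inv \<tau>)) \<tau>"
      using vec_act_comp[OF signed_perms_inv[OF that(1)] that(1), of u] vec_act_id[OF that(2)] by simp
    show "vec_act n u (Hilbert_Choice.inv \<tau>) \<in> int_vecs n"
      by (rule vec_act_in_int_vecs[OF signed_perms_inv[OF that(1)]])
  qed
  then have "(\<exists>g\<in>carrier (affine_C n). P g) \<longleftrightarrow>
      (\<exists>\<tau>\<in>signed_perms n. \<exists>t\<in>int_vecs n. P (\<tau>, vec_act n t \<tau>))" for P
    by (fastforce simp: carrier_affine_C intro: vec_act_in_int_vecs)
  then show ?thesis
    unfolding conjugate_in_iff[OF carr] using commute_iff by simp
qed

section \<open>Elements whose square is the identity\<close>

text \<open>Square one is demanded rather than order two, so that the identity, which is the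
  standard element with \<open>m = ke = ko = 0\<close>, is covered as well.\<close>

locale self_inverse =
  fixes n :: nat and \<sigma> v :: "int \<Rightarrow> int"
  assumes perm: "\<sigma> \<in> signed_perms n"
    and vec: "v \<in> int_vecs n"
    and invol: "\<sigma> (\<sigma> k) = k"
    and label: "odd_ext v (\<sigma> k) = - odd_ext v k"

text \<open>The square of \<open>(\<sigma>, v)\<close> has second component
  \<open>v^\<sigma> + v\<close>; its odd extension at \<open>\<sigma> k\<close> is
  \<open>V k + V (\<sigma> k)\<close>, which gives the label condition.\<close>

lemma self_inverseI:
  assumes "x \<in> carrier (affine_C n)" "x \<otimes>\<^bsub>affine_C n\<^esub> x = \<one>\<^bsub>affine_C n\<^esub>"
  shows "self_inverse n (fst x) (snd x)"
proof
  obtain \<sigma> v where x: "x = (\<sigma>, v)"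
    by fastforce
  show \<sigma>: "fst x \<in> signed_perms n" and v: "snd x \<in> int_vecs n"
    using assms(1) by (auto simp: carrier_affine_C)
  have eqs: "\<sigma> \<circ> \<sigma> = id" "\<And>j. vec_act n v \<sigma> j + v j = 0"
    using assms(2) by (auto simp: x mult_affine_C affine_C_def fun_eq_iff)
  show "fst x (fst x k) = k" for k
    using eqs(1) by (simp add: x fun_eq_iff)
  have "odd_ext (\<lambda>j. vec_act n v \<sigma> j + v j) (\<sigma> k) = 0" for k
    by (simp add: eqs(2) odd_ext_def)
  then show "odd_ext (snd x) (fst x k) = - odd_ext (snd x) k" for k
    using odd_ext_vec_act[of \<sigma> n v k] \<sigma> v
    by (simp add: odd_ext_add x eq_neg_iff_add_eq_0) (metis add.commute)
qed

lemma is_involution_self_inverse: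
  assumes "is_involution (affine_C n) x"
  shows "self_inverse n (fst x) (snd x)"
proof (rule self_inverseI)
  interpret group "affine_C n"
    by (rule affine_C_group)
  show x: "x \<in> carrier (affine_C n)"
    using assms by (simp add: is_involution_def)
  have "x [^]\<^bsub>affine_C n\<^esub> (2::nat) = \<one>\<^bsub>affine_C n\<^esub>"
    using pow_ord_eq_1[OF x] assms by (simp add: is_involution_def)
  then show "x \<otimes>\<^bsub>affine_C n\<^esub> x = \<one>\<^bsub>affine_C n\<^esub>"
    using x by (simp add: numeral_2_eq_2)
qed

section \<open>Counting the labelled cycles\<close>

lemma finite_interval_filter: "finite {a \<in> {1..int n}. P a}"
  by (rule finite_subset[of _ "{1..int n}"]) auto

text \<open>The map sending \<open>a\<close> to \<open>\<bar>\<tau> a\<bar>\<close> is injective on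
  \<open>{1..n}\<close>: equal values mean \<open>a = b\<close> or \<open>a = - b\<close>, and both
  are positive. An inequality suffices, since conjugacy is symmetric.\<close>

lemma card_le_if_conjugates:
  assumes \<tau>: "\<tau> \<in> signed_perms n"
    and impl: "\<And>a. a \<in> {1..int n} \<Longrightarrow> P a \<Longrightarrow> Q \<bar>\<tau> a\<bar>"
  shows "card {a \<in> {1..int n}. P a} \<le> card {a \<in> {1..int n}. Q a}"
proof (rule card_inj_on_le)
  show "inj_on (\<lambda>a. \<bar>\<tau> a\<bar>) {a \<in> {1..int n}. P a}"
  proof (rule inj_onI)
    fix a b assume ab: "a \<in> {a \<in> {1..int n}. P a}" "b \<in> {a \<in> {1..int n}. P a}" "\<bar>\<tau> a\<bar> = \<bar>\<tau> b\<bar>"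
    then have "\<tau> a = \<tau> b \<or> \<tau> a = \<tau> (- b)"
      using signed_permsD(2)[OF \<tau>] by (auto simp: abs_eq_iff)
    then show "a = b"
      using ab signed_perms_inj[OF \<tau>] by auto
  qed
  show "(\<lambda>a. \<bar>\<tau> a\<bar>) ` {a \<in> {1..int n}. P a} \<subseteq> {a \<in> {1..int n}. Q a}"
    using impl signed_perms_abs_in[OF \<tau>] by blast
qed (rule finite_interval_filter)

context self_inverse
begin

text \<open>\<open>reps\<close> takes the smaller index of each transposition; \<open>fixed\<close>
  omits the label because \<open>fixed_label\<close> forces it to be 0.\<close>

abbreviation "reps \<equiv> {a \<in> {1..int n}. a < \<bar>\<sigma> a\<bar>}"
abbreviation "neg_even \<equiv> {a \<in> {1..int n}. \<sigma> a = - a \<and> even (v a)}"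
abbreviation "neg_odd \<equiv> {a \<in> {1..int n}. \<sigma> a = - a \<and> odd (v a)}"
abbreviation "fixed \<equiv> {a \<in> {1..int n}. \<sigma> a = a}"

lemma abs_invol: "a \<ge> 0 \<Longrightarrow> \<bar>\<sigma> \<bar>\<sigma> a\<bar>\<bar> = a"
  using signed_perms_abs[OF perm, of "\<sigma> a"] invol[of a] by (auto split: if_splits)

lemma label_eq:
  assumes "a \<in> {1..int n}"
  shows "sgn (\<sigma> a) * v \<bar>\<sigma> a\<bar> = - v a"
  using label[of a] assms by (simp add: odd_ext_def)

lemma fixed_label: "a \<in> {1..int n} \<Longrightarrow> \<sigma> a = a \<Longrightarrow> v a = 0"
  using label_eq[of a] by simp

text \<open>The labels of a transposition match automatically by \<open>label_eq\<close>, the sign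
  of \<open>\<sigma> a\<close> choosing the kind. What remains is the pair
  \<open>{a, \<bar>\<sigma> a\<bar>}\<close>, counted once by its smaller index.\<close>

lemma card_transpositions:
  "card {{a, b} | a b. a \<in> {1..int n} \<and> b \<in> {1..int n} \<and>
     (\<exists>c. pos_transposition (\<sigma>, v) a b c \<or> neg_transposition (\<sigma>, v) a b c)} = card reps"
  (is "card ?T = _")
proof -
  have char: "(\<exists>c. pos_transposition (\<sigma>, v) a b c \<or> neg_transposition (\<sigma>, v) a b c) \<longleftrightarrow>
      a \<noteq> b \<and> b = \<bar>\<sigma> a\<bar>" if ab: "a \<in> {1..int n}" "b \<in> {1..int n}" for a b
  proof
    assume b: "a \<noteq> b \<and> b = \<bar>\<sigma> a\<bar>"
    then have "\<sigma> b = (if \<sigma> a < 0 then - a else a)"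
      using signed_perms_abs[OF perm, of "\<sigma> a"] invol[of a] by simp
    moreover have "sgn (\<sigma> a) * v b = - v a"
      using label_eq[OF ab(1)] b by simp
    moreover have "\<sigma> a = b \<or> \<sigma> a = - b" "b > 0"
      using b ab by auto
    ultimately show "\<exists>c. pos_transposition (\<sigma>, v) a b c \<or> neg_transposition (\<sigma>, v) a b c"
      using b by (auto simp: pos_transposition_def neg_transposition_def)
  next
    assume "\<exists>c. pos_transposition (\<sigma>, v) a b c \<or> neg_transposition (\<sigma>, v) a b c"
    then have "a \<noteq> b \<and> (\<sigma> a = b \<or> \<sigma> a = - b)"
      by (auto simp only: pos_transposition_def neg_transposition_def fst_conv)
    then show "a \<noteq> b \<and> b = \<bar>\<sigma> a\<bar>"
      using ab by auto
  qed
  have "?T = (\<lambda>a. {a, \<bar>\<sigma> a\<bar>}) ` reps"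
  proof (intro equalityI subsetI)
    fix s assume "s \<in> ?T"
    then obtain a b where s: "s = {a, b}" and ab: "a \<in> {1..int n}" "b \<in> {1..int n}"
      and b: "a \<noteq> b" "\<bar>\<sigma> a\<bar> = b"
      using char by blast
    have a: "\<bar>\<sigma> b\<bar> = a"
      using abs_invol[of a] ab b by simp
    have "s = {a, \<bar>\<sigma> a\<bar>}" "s = {b, \<bar>\<sigma> b\<bar>}"
      unfolding a b s by (rule refl, rule insert_commute)
    moreover have "a \<in> reps \<or> b \<in> reps"
      using ab b a by auto
    ultimately show "s \<in> (\<lambda>a. {a, \<bar>\<sigma> a\<bar>}) ` reps"
      by blast
  next
    fix s assume "s \<in> (\<lambda>a. {a, \<bar>\<sigma> a\<bar>}) ` reps"
    then obtain a where s: "s = {a, \<bar>\<sigma> a\<bar>}" and a: "a \<in> {1..int n}" "a \<noteq> \<bar>\<sigma> a\<bar>"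
      by force
    then show "s \<in> ?T"
      using char[OF a(1) signed_perms_abs_in[OF perm a(1)]] signed_perms_abs_in[OF perm a(1)] by blast
  qed
  moreover have "inj_on (\<lambda>a. {a, \<bar>\<sigma> a\<bar>}) reps"
    by (rule inj_onI) (auto simp: doubleton_eq_iff)
  ultimately show ?thesis
    by (simp add: card_image)
qed

lemma labelled_cycle_type_eq:
  "labelled_cycle_type n (\<sigma>, v) = (card reps, card neg_even, card neg_odd, card fixed)"
proof -
  have "{a \<in> {1..int n}. pos_1cycle (\<sigma>, v) a} = fixed"
    using fixed_label by (auto simp: pos_1cycle_def)
  then show ?thesis
    by (simp add: labelled_cycle_type_def card_transpositions neg_1cycle_def del: atLeastAtMost_iff)
qed

lemma classes: "{1..int n} = reps \<union> (\<lambda>a. \<bar>\<sigma> a\<bar>) ` reps \<union> neg_even \<union> neg_odd \<union> fixed"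
proof (intro equalityI subsetI)
  fix a assume a: "a \<in> {1..int n}"
  consider "a < \<bar>\<sigma> a\<bar>" | "\<bar>\<sigma> a\<bar> < a" | "\<sigma> a = - a" | "\<sigma> a = a"
    by linarith
  then show "a \<in> reps \<union> (\<lambda>a. \<bar>\<sigma> a\<bar>) ` reps \<union> neg_even \<union> neg_odd \<union> fixed"
  proof cases
    \<comment> \<open>The larger index of a pair is the image of the smaller one, by
      \<open>abs_invol\<close>.\<close>
    case 2
    then have "a = \<bar>\<sigma> \<bar>\<sigma> a\<bar>\<bar>" "\<bar>\<sigma> a\<bar> \<in> reps"
      using a abs_invol[of a] signed_perms_abs_in[OF perm a] by auto
    then show ?thesis
      by blast
  qed (use a in auto)
qed (use signed_perms_abs_in[OF perm] in auto)

text \<open>The larger indices of the pairs correspond bijectively to \<open>reps\<close>. The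
  identity recovers the number of transpositions from the other three counts, so pairs need not be
  counted again.\<close>

lemma card_classes: "2 * card reps + card neg_even + card neg_odd + card fixed = n"
proof -
  let ?D = "(\<lambda>a. \<bar>\<sigma> a\<bar>) ` reps"
  have D: "\<bar>\<sigma> a\<bar> < a" if "a \<in> ?D" for a
    using that abs_invol by auto
  have inj: "inj_on (\<lambda>a. \<bar>\<sigma> a\<bar>) reps"
    using abs_invol by (intro inj_on_inverseI[where g = "\<lambda>a. \<bar>\<sigma> a\<bar>"]) auto
  have fin: "finite reps" "finite neg_even" "finite neg_odd" "finite fixed"
    by (rule finite_interval_filter)+
  have disj: "reps \<inter> ?D = {}" "(reps \<union> ?D) \<inter> neg_even = {}"
      "(reps \<union> ?D \<union> neg_even) \<inter> neg_odd = {}" "(reps \<union> ?D \<union> neg_even \<union> neg_odd) \<inter> fixed = {}"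
    using D by fastforce+
  have "n = card (reps \<union> ?D \<union> neg_even \<union> neg_odd \<union> fixed)"
    unfolding classes[symmetric] by simp
  also have "\<dots> = card reps + card ?D + card neg_even + card neg_odd + card fixed"
    by (simp only: card_Un_disjoint finite_Un finite_imageI fin disj)
  also have "card ?D = card reps"
    by (rule card_image[OF inj])
  finally show ?thesis
    by simp
qed

end

section \<open>Invariance of the labelled cycle type\<close>

text \<open>Conjugation carries the index \<open>a\<close> to \<open>\<bar>\<tau> a\<bar>\<close>.
  On a negative 1-cycle the label equation reduces to \<open>W (\<tau> a) = V a + 2 T a\<close>, and
  passing to \<open>\<bar>\<tau> a\<bar>\<close> changes at most the sign, so the parity
  survives.\<close>

lemma conjugate_cards_le:
  assumes x: "self_inverse n \<sigma> v" and y: "self_inverse n \<rho> w"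
    and conj: "conjugate_in (affine_C n) (\<sigma>, v) (\<rho>, w)"
  shows "card {a \<in> {1..int n}. \<sigma> a = - a \<and> even (v a)} \<le> card {a \<in> {1..int n}. \<rho> a = - a \<and> even (w a)}"
    and "card {a \<in> {1..int n}. \<sigma> a = - a \<and> odd (v a)} \<le> card {a \<in> {1..int n}. \<rho> a = - a \<and> odd (w a)}"
    and "card {a \<in> {1..int n}. \<sigma> a = a} \<le> card {a \<in> {1..int n}. \<rho> a = a}"
proof -
  interpret x: self_inverse n \<sigma> v by (rule x)
  interpret y: self_inverse n \<rho> w by (rule y)
  obtain \<tau> t where \<tau>: "\<tau> \<in> signed_perms n"
    and comm: "\<And>k. \<tau> (\<sigma> k) = \<rho> (\<tau> k)"
    and lab: "\<And>k. odd_ext w (\<tau> (\<sigma> k)) + odd_ext t k = odd_ext v (\<sigma> k) + odd_ext t (\<sigma> k)"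
    using conj conjugate_affine_C_iff[OF x.perm x.vec y.perm y.vec] by blast
  have neg: "\<rho> \<bar>\<tau> a\<bar> = - \<bar>\<tau> a\<bar> \<and> (even (w \<bar>\<tau> a\<bar>) \<longleftrightarrow> even (v a))"
    if a: "a \<in> {1..int n}" "\<sigma> a = - a" for a
  proof
    show "\<rho> \<bar>\<tau> a\<bar> = - \<bar>\<tau> a\<bar>"
      using comm[of a] a signed_perms_abs[OF y.perm, of "\<tau> a"] signed_permsD(2)[OF \<tau>, of a]
      by (auto simp: abs_if split: if_splits)
    have "odd_ext w (\<tau> a) = v a + 2 * t a"
      using lab[of a] a signed_permsD(2)[OF \<tau>, of a] by (simp add: odd_ext_pos)
    moreover have "even (odd_ext w (\<tau> a)) \<longleftrightarrow> even (w \<bar>\<tau> a\<bar>)"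
      using signed_perms_abs_in[OF \<tau> a(1)] by (auto simp: odd_ext_def sgn_if)
    ultimately show "even (w \<bar>\<tau> a\<bar>) \<longleftrightarrow> even (v a)"
      by simp
  qed
  have pos: "\<rho> \<bar>\<tau> a\<bar> = \<bar>\<tau> a\<bar>" if "\<sigma> a = a" for a
    using comm[of a] that signed_perms_abs[OF y.perm, of "\<tau> a"] by (auto simp: abs_if)
  show "card {a \<in> {1..int n}. \<sigma> a = - a \<and> even (v a)} \<le> card {a \<in> {1..int n}. \<rho> a = - a \<and> even (w a)}"
    by (rule card_le_if_conjugates[OF \<tau>]) (use neg in auto)
  show "card {a \<in> {1..int n}. \<sigma> a = - a \<and> odd (v a)} \<le> card {a \<in> {1..int n}. \<rho> a = - a \<and> odd (w a)}"
    by (rule card_le_if_conjugates[OF \<tau>]) (use neg in auto)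
  show "card {a \<in> {1..int n}. \<sigma> a = a} \<le> card {a \<in> {1..int n}. \<rho> a = a}"
    by (rule card_le_if_conjugates[OF \<tau>]) (use pos in auto)
qed

text \<open>The inequalities in both directions give equality of the last three entries;
  \<open>card_classes\<close> then yields the first.\<close>

lemma conjugate_labelled_cycle_type:
  assumes x: "self_inverse n (fst x) (snd x)" and y: "self_inverse n (fst y) (snd y)"
    and conj: "conjugate_in (affine_C n) x y"
  shows "labelled_cycle_type n x = labelled_cycle_type n y"
proof -
  obtain \<sigma> v \<rho> w where eq: "x = (\<sigma>, v)" "y = (\<rho>, w)"
    by fastforce
  interpret x: self_inverse n \<sigma> v using x eq by simp
  interpret y: self_inverse n \<rho> w using y eq by simp
  interpret group "affine_C n" by (rule affine_C_group)
  have c: "conjugate_in (affine_C n) (\<sigma>, v) (\<rho>, w)" "conjugate_in (affine_C n) (\<rho>, w) (\<sigma>, v)"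
    using conj conjugate_in_sym eq by auto
  note le = conjugate_cards_le[OF x.self_inverse_axioms y.self_inverse_axioms c(1)]
    and ge = conjugate_cards_le[OF y.self_inverse_axioms x.self_inverse_axioms c(2)]
  show ?thesis
    using le ge x.card_classes y.card_classes
    unfolding eq x.labelled_cycle_type_eq y.labelled_cycle_type_eq by simp
qed

section \<open>Cycle types of the standard elements\<close>

lemma standard_elt_self_inverse:
  assumes "2 * m + ke + ko + l = n"
  shows "self_inverse n (fst (standard_elt n m ke ko l)) (snd (standard_elt n m ke ko l))"
proof
  show "fst (standard_elt n m ke ko l) \<in> signed_perms n" "snd (standard_elt n m ke ko l) \<in> int_vecs n"
    using standard_elt_in_carrier[OF assms] by (auto simp: carrier_affine_C)
  show "fst (standard_elt n m ke ko l) (fst (standard_elt n m ke ko l) k) = k" for k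
    by (auto simp: standard_elt_def sgn_if abs_if; presburger)
  show "odd_ext (snd (standard_elt n m ke ko l)) (fst (standard_elt n m ke ko l) k) =
      - odd_ext (snd (standard_elt n m ke ko l)) k" for k
    using assms by (auto simp: standard_elt_def odd_ext_def sgn_if abs_if; presburger)
qed

text \<open>Only the 1-cycles are located, as blocks of consecutive integers;
  \<open>card_classes\<close> then leaves \<open>m\<close> for the transpositions.\<close>

lemma labelled_cycle_type_standard_elt:
  assumes n: "2 * m + ke + ko + l = n"
  shows "labelled_cycle_type n (standard_elt n m ke ko l) = (m, ke, ko, l)"
proof -
  obtain \<rho> w where eq: "standard_elt n m ke ko l = (\<rho>, w)"
    by fastforce
  interpret self_inverse n \<rho> w
    using standard_elt_self_inverse[OF n] eq by simp
  have \<rho>: "\<rho> = fst (standard_elt n m ke ko l)" and w: "w = snd (standard_elt n m ke ko l)"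
    by (simp_all add: eq)
  have paired: "\<bar>\<rho> a\<bar> \<noteq> a" if "a \<in> {1..2 * int m}" for a
    using that by (auto simp: \<rho> standard_elt_def)
  have neg: "\<rho> a = - a" if "a \<in> {2 * int m + 1..int n - int l}" for a
    using that by (auto simp: \<rho> standard_elt_def)
  have pos: "\<rho> a = a" if "a \<in> {int n - int l + 1..int n}" for a
    using that n by (auto simp: \<rho> standard_elt_def)
  have w_eq: "w a = (if a \<in> {2 * int m + int ke + 1..int n - int l} then 1 else 0)" for a
    by (auto simp: w standard_elt_def)
  have range: "a \<in> {1..2 * int m} \<or> a \<in> {2 * int m + 1..int n - int l} \<or> a \<in> {int n - int l + 1..int n}"
    if "a \<in> {1..int n}" for a
    using that by auto
  have neg_iff: "\<rho> a = - a \<longleftrightarrow> a \<in> {2 * int m + 1..int n - int l}"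
    and pos_iff: "\<rho> a = a \<longleftrightarrow> a \<in> {int n - int l + 1..int n}" if "a \<in> {1..int n}" for a
    using range[OF that] paired[of a] neg[of a] pos[of a] that by auto
  have "neg_even = {2 * int m + 1..2 * int m + int ke}"
    using n neg_iff by (auto simp: w_eq split: if_splits)
  then have ke: "card neg_even = ke"
    by simp
  have "neg_odd = {2 * int m + int ke + 1..int n - int l}"
    using n neg_iff by (auto simp: w_eq split: if_splits)
  then have ko: "card neg_odd = ko"
    using n by simp
  have "fixed = {int n - int l + 1..int n}"
    using n pos_iff by auto
  then have l: "card fixed = l"
    by simp
  show ?thesis
    using card_classes n unfolding eq labelled_cycle_type_eq ke ko l by simp
qed

section \<open>Construction of the conjugating element\<close>

text \<open>The odd extension of \<open>f\<close> reaches \<open>j\<close> from \<open>i\<close> or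
  from \<open>- i\<close>, where \<open>\<bar>f i\<bar> = \<bar>j\<bar>\<close>. It thus maps a
  finite set onto itself and is bijective there.\<close>

lemma signed_perm_of_abs_surj:
  assumes surj: "(\<lambda>i. \<bar>f i\<bar>) ` {1..int n} = {1..int n}"
  shows "(\<lambda>k. if \<bar>k\<bar> \<le> int n then sgn k * f \<bar>k\<bar> else k) \<in> signed_perms n" (is "?t \<in> _")
proof -
  let ?S = "{k. 1 \<le> \<bar>k\<bar> \<and> \<bar>k\<bar> \<le> int n}"
  have fin: "finite ?S"
    by (rule finite_subset[of _ "{- int n..int n}"]) auto
  have abs_f: "\<bar>f i\<bar> \<in> {1..int n}" if "i \<in> {1..int n}" for i
    using surj that by blast
  have "?t ` ?S = ?S"
  proof (intro equalityI subsetI)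
    fix j assume "j \<in> ?t ` ?S"
    then obtain k where "k \<in> ?S" "j = ?t k"
      by blast
    then show "j \<in> ?S"
      using abs_f[of "\<bar>k\<bar>"] by (auto simp: abs_mult sgn_if)
  next
    fix j assume j: "j \<in> ?S"
    then have "\<bar>j\<bar> \<in> (\<lambda>i. \<bar>f i\<bar>) ` {1..int n}"
      unfolding surj by simp
    then obtain i where i: "i \<in> {1..int n}" "\<bar>j\<bar> = \<bar>f i\<bar>"
      by blast
    have "j = ?t i \<and> i \<in> ?S \<or> j = ?t (- i) \<and> - i \<in> ?S"
      using i by (auto simp: sgn_if abs_eq_iff)
    then show "j \<in> ?t ` ?S"
      by blast
  qed
  then have "bij_betw ?t ?S ?S"
    using fin by (simp add: bij_betw_def eq_card_imp_inj_on)
  then have "?t permutes ?S"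
    by (rule bij_imp_permutes) (auto simp: sgn_if)
  then show ?thesis
    by (auto simp: signed_perms_def sgn_minus)
qed

text \<open>Both equations are odd in \<open>k\<close> and trivial at 0; for
  \<open>\<bar>k\<bar> > n\<close> the permutations fix \<open>k\<close> and the labels of
  \<open>v\<close> and \<open>w\<close> vanish.\<close>

lemma conjugate_affine_CI:
  assumes \<sigma>: "\<sigma> \<in> signed_perms n" and v: "v \<in> int_vecs n"
    and \<rho>: "\<rho> \<in> signed_perms n" and w: "w \<in> int_vecs n"
    and \<tau>: "\<tau> \<in> signed_perms n" and t: "t \<in> int_vecs n"
    and comm: "\<And>k. k \<in> {1..int n} \<Longrightarrow> \<tau> (\<sigma> k) = \<rho> (\<tau> k)"
    and lab: "\<And>k. k \<in> {1..int n} \<Longrightarrow>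
      odd_ext w (\<tau> (\<sigma> k)) + odd_ext t k = odd_ext v (\<sigma> k) + odd_ext t (\<sigma> k)"
  shows "conjugate_in (affine_C n) (\<sigma>, v) (\<rho>, w)"
proof -
  note odd = signed_permsD(2)[OF \<sigma>] signed_permsD(2)[OF \<rho>] signed_permsD(2)[OF \<tau>]
  have "\<tau> (\<sigma> k) = \<rho> (\<tau> k) \<and>
      odd_ext w (\<tau> (\<sigma> k)) + odd_ext t k = odd_ext v (\<sigma> k) + odd_ext t (\<sigma> k)" for k
  proof -
    consider "k \<in> {1..int n}" | "- k \<in> {1..int n}" | "k = 0" | "\<not> \<bar>k\<bar> \<le> int n"
      by fastforce
    then show ?thesis
    proof cases
      case 1
      then show ?thesis
        using comm lab by blast
    next
      case 2
      show ?thesis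
        using comm[OF 2] lab[OF 2] by (simp add: odd)
    next
      case 3
      then show ?thesis
        using \<sigma> \<rho> \<tau> by (simp add: signed_perms_0)
    next
      case 4
      then have "\<sigma> k = k" "\<rho> k = k" "\<tau> k = k"
        using \<sigma> \<rho> \<tau> signed_perms_outside by blast+
      moreover have "odd_ext v k = 0" "odd_ext w k = 0"
        using v w 4 by (auto simp: odd_ext_def int_vecs_def)
      ultimately show ?thesis
        by simp
    qed
  qed
  then show ?thesis
    using \<tau> t conjugate_affine_C_iff[OF \<sigma> v \<rho> w] by blast
qed

text \<open>This numbers a class by a block of consecutive integers. With left end
  \<open>p + 1\<close>, the end of one block of 1-cycles serves as \<open>p\<close> for the
  next.\<close>

lemma finite_int_enumeration:
  fixes p q :: int
  assumes "finite A" and q: "q = p + int (card A)"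
  shows "\<exists>h. h ` {p + 1..q} = A"
proof -
  have "card {p + 1..q} = card A"
    using q by simp
  then obtain h where "bij_betw h {p + 1..q} A"
    using assms(1) finite_same_card_bij[of "{p + 1..q}" A] by auto
  then show ?thesis
    using bij_betw_imp_surj_on by blast
qed

text \<open>The conjugation runs from the standard element to \<open>(\<sigma>, v)\<close>, so that
  \<tau> sends positions to indices and can be defined by listing the classes block by
  block.\<close>

lemma (in self_inverse) conjugate_standard_elt:
  "conjugate_in (affine_C n)
     (standard_elt n (card reps) (card neg_even) (card neg_odd) (card fixed)) (\<sigma>, v)"
proof -
  define m ke ko l where card: "m = card reps" "ke = card neg_even" "ko = card neg_odd" "l = card fixed"
  have n: "2 * m + ke + ko + l = n"
    using card_classes by (simp add: card)
  obtain \<rho> w where eq: "standard_elt n m ke ko l = (\<rho>, w)"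
    by fastforce
  have \<rho>_def: "\<rho> = fst (standard_elt n m ke ko l)" and w_def: "w = snd (standard_elt n m ke ko l)"
    by (simp_all add: eq)
  interpret std: self_inverse n \<rho> w
    using standard_elt_self_inverse[OF n] eq by simp
  note enumeration = finite_int_enumeration[OF finite_interval_filter]
  have "int m = 0 + int (card reps)"
    and "2 * int m + int ke = 2 * int m + int (card neg_even)"
    and "int n - int l = 2 * int m + int ke + int (card neg_odd)"
    and "int n = int n - int l + int (card fixed)"
    using n unfolding card[symmetric] by simp_all
  then obtain r e d p where "r ` {0 + 1..int m} = reps"
    and e: "e ` {2 * int m + 1..2 * int m + int ke} = neg_even"
    and d: "d ` {2 * int m + int ke + 1..int n - int l} = neg_odd"
    and p: "p ` {int n - int l + 1..int n} = fixed"
    by (elim enumeration[THEN exE])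
  then have r: "r ` {1..int m} = reps"
    unfolding add_0 by blast
  \<comment> \<open>Position \<open>2 * i\<close> takes \<open>\<sigma> (r i)\<close> with its sign;
    all other values on \<open>{1..n}\<close> are positive.\<close>
  define f where "f i = (if i \<le> 2 * int m then if odd i then r ((i + 1) div 2) else \<sigma> (r (i div 2))
      else if i \<le> 2 * int m + int ke then e i
      else if i \<le> int n - int l then d i else p i)" for i
  have f_odd: "f (2 * i - 1) = r i" and f_even: "f (2 * i) = \<sigma> (r i)"
    if "i \<in> {1..int m}" for i
    using that by (auto simp: f_def)
  have f_e: "f i = e i" if "i \<in> {2 * int m + 1..2 * int m + int ke}" for i
    using that by (auto simp: f_def)
  have f_d: "f i = d i" if "i \<in> {2 * int m + int ke + 1..int n - int l}" for i
    using that by (auto simp: f_def)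
  have f_p: "f i = p i" if "i \<in> {int n - int l + 1..int n}" for i
    using that n by (auto simp: f_def)
  have "{1..int n} \<subseteq> (\<lambda>i. \<bar>f i\<bar>) ` {1..int n}"
  proof
    fix a assume a: "a \<in> {1..int n}"
    then have "a \<in> reps \<union> (\<lambda>a. \<bar>\<sigma> a\<bar>) ` reps \<union> neg_even \<union> neg_odd \<union> fixed"
      using classes by (rule back_subst)
    then consider i where "i \<in> {1..int m}" "a = r i"
      | i where "i \<in> {1..int m}" "a = \<bar>\<sigma> (r i)\<bar>"
      | i where "i \<in> {2 * int m + 1..2 * int m + int ke}" "a = e i"
      | i where "i \<in> {2 * int m + int ke + 1..int n - int l}" "a = d i"
      | i where "i \<in> {int n - int l + 1..int n}" "a = p i"
      unfolding r[symmetric] e[symmetric] d[symmetric] p[symmetric] by blast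
    then have "\<exists>i\<in>{1..int n}. \<bar>a\<bar> = \<bar>f i\<bar>"
    proof cases
      case (1 i)
      then show ?thesis
        using f_odd n by (intro bexI[of _ "2 * i - 1"]) auto
    next
      case (2 i)
      then show ?thesis
        using f_even n by (intro bexI[of _ "2 * i"]) auto
    next
      case (3 i)
      then show ?thesis
        using f_e n by (intro bexI[of _ i]) auto
    next
      case (4 i)
      then show ?thesis
        using f_d n by (intro bexI[of _ i]) auto
    next
      case (5 i)
      then show ?thesis
        using f_p n by (intro bexI[of _ i]) auto
    qed
    then show "a \<in> (\<lambda>i. \<bar>f i\<bar>) ` {1..int n}"
      using a by auto
  qed
  \<comment> \<open>An image of \<open>{1..n}\<close> has at most \<open>n\<close> elements, so the
    inclusion is an equality.\<close>
  then have surj: "(\<lambda>i. \<bar>f i\<bar>) ` {1..int n} = {1..int n}"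
    using card_seteq[of "(\<lambda>i. \<bar>f i\<bar>) ` {1..int n}" "{1..int n}"] card_image_le[of "{1..int n}" "\<lambda>i. \<bar>f i\<bar>"]
    by simp
  define \<tau> where "\<tau> k = (if \<bar>k\<bar> \<le> int n then sgn k * f \<bar>k\<bar> else k)" for k
  have \<tau>: "\<tau> \<in> signed_perms n"
    using signed_perm_of_abs_surj[OF surj] by (simp add: \<tau>_def[abs_def])
  have \<tau>_f: "\<tau> k = f k" if "k \<in> {1..int n}" for k
    using that by (simp add: \<tau>_def)
  \<comment> \<open>On a pair \<open>(2i-1 2i)\<close> the labels of \<open>t\<close> only need the right difference; on a negative
    1-cycle \<open>t\<close> is half of the difference of the two labels.\<close>
  define t where "t i = (if i \<notin> {1..int n} then 0
      else if i \<le> 2 * int m then if odd i then odd_ext v (f i) else 0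
      else odd_ext v (f i) div 2)" for i
  have t: "t \<in> int_vecs n"
    by (auto simp: int_vecs_def t_def)
  \<comment> \<open>Compared with the conjugacy criterion, \<open>(\<rho>, w)\<close> and
    \<open>(\<sigma>, v)\<close> have exchanged places.\<close>
  have main: "\<tau> (\<rho> k) = \<sigma> (\<tau> k) \<and>
      odd_ext v (\<tau> (\<rho> k)) + odd_ext t k = odd_ext w (\<rho> k) + odd_ext t (\<rho> k)"
    if k: "k \<in> {1..int n}" for k
  proof -
    consider i where "i \<in> {1..int m}" "k = 2 * i - 1"
      | i where "i \<in> {1..int m}" "k = 2 * i"
      | "k \<in> {2 * int m + 1..2 * int m + int ke}"
      | "k \<in> {2 * int m + int ke + 1..int n - int l}"
      | "k \<in> {int n - int l + 1..int n}"
    proof -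
      have "(\<exists>i\<in>{1..int m}. k = 2 * i - 1 \<or> k = 2 * i) \<or> k > 2 * int m"
        using k by (auto simp: Bex_def; presburger)
      then show ?thesis
        using that k by fastforce
    qed
    then show ?thesis
    proof cases
      case (1 i)
      then have "\<rho> k = 2 * i"
        by (simp add: \<rho>_def standard_elt_def)
      moreover have "\<tau> k = r i" "\<tau> (2 * i) = \<sigma> (r i)"
        using 1 n f_odd f_even by (simp_all add: \<tau>_f)
      moreover have "odd_ext w (2 * i) = 0" "odd_ext t k = odd_ext v (r i)" "odd_ext t (2 * i) = 0"
        using 1 n k f_odd[OF 1(1)] by (auto simp: odd_ext_pos w_def standard_elt_def t_def)
      ultimately show ?thesis
        by (simp add: label)
    next
      case (2 i)
      then have "\<rho> k = 2 * i - 1"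
        by (simp add: \<rho>_def standard_elt_def)
      moreover have "\<tau> k = \<sigma> (r i)" "\<tau> (2 * i - 1) = r i"
        using 2 n f_odd f_even by (simp_all add: \<tau>_f)
      moreover have "odd_ext w (2 * i - 1) = 0" "odd_ext t k = 0"
          "odd_ext t (2 * i - 1) = odd_ext v (r i)"
        using 2 n k f_odd[OF 2(1)] by (auto simp: odd_ext_pos w_def standard_elt_def t_def)
      ultimately show ?thesis
        by (simp add: invol)
    next
      case 3
      then have "e k \<in> neg_even"
        using e by blast
      then have fk: "\<sigma> (f k) = - f k" "even (odd_ext v (f k))"
        using 3 f_e by (auto simp: odd_ext_pos)
      have "\<rho> k = - k"
        using 3 n by (simp add: \<rho>_def standard_elt_def)
      moreover have "\<tau> k = f k" "\<tau> (- k) = - f k"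
        using k by (simp_all add: \<tau>_f signed_permsD(2)[OF \<tau>])
      moreover have "odd_ext w k = 0" "odd_ext t k = odd_ext v (f k) div 2"
        using 3 k by (auto simp: odd_ext_pos w_def standard_elt_def t_def)
      ultimately show ?thesis
        using fk by auto
    next
      case 4
      then have "d k \<in> neg_odd"
        using d by blast
      then have fk: "\<sigma> (f k) = - f k" "odd (odd_ext v (f k))"
        using 4 f_d by (auto simp: odd_ext_pos)
      have "\<rho> k = - k"
        using 4 n by (simp add: \<rho>_def standard_elt_def)
      moreover have "\<tau> k = f k" "\<tau> (- k) = - f k"
        using k by (simp_all add: \<tau>_f signed_permsD(2)[OF \<tau>])
      \<comment> \<open>For \<open>V = 2 q + 1\<close> and standard label 1 the required translation
        is \<open>(V - 1) / 2 = q\<close>, which is what \<open>div\<close> gives by rounding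
        down.\<close>
      moreover have "odd_ext w k = 1" "odd_ext t k = odd_ext v (f k) div 2"
        using 4 k by (auto simp: odd_ext_pos w_def standard_elt_def t_def)
      ultimately show ?thesis
        using fk by (auto elim!: oddE)
    next
      case 5
      then have "p k \<in> fixed"
        using p by blast
      then have fk: "\<sigma> (f k) = f k" "odd_ext v (f k) = 0"
        using 5 f_p fixed_label by (auto simp: odd_ext_pos)
      \<comment> \<open>At a fixed position \<open>T k\<close> stands on both sides and cancels; the
        labels on both sides are 0.\<close>
      have "\<rho> k = k"
        using 5 n by (simp add: \<rho>_def standard_elt_def)
      moreover have "\<tau> k = f k"
        using k by (simp add: \<tau>_f)
      moreover have "odd_ext w k = 0"
        using 5 k by (auto simp: odd_ext_pos w_def standard_elt_def)
      ultimately show ?thesis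
        using fk by simp
    qed
  qed
  show ?thesis
    using conjugate_affine_CI[OF std.perm std.vec perm vec \<tau> t] main
    unfolding card[symmetric] eq by blast
qed

section \<open>Classification of the involutions\<close>

theorem theorem2p6:
  fixes n :: nat
  assumes "n \<ge> 2"
  shows "(\<forall>x y. is_involution (affine_C n) x \<longrightarrow> is_involution (affine_C n) y \<longrightarrow>
            (conjugate_in (affine_C n) x y \<longleftrightarrow> labelled_cycle_type n x = labelled_cycle_type n y)) \<and>
         (\<forall>x. is_involution (affine_C n) x \<longrightarrow>
            (\<exists>!a. (\<exists>m ke ko l. 2 * m + ke + ko + l = n \<and> a = standard_elt n m ke ko l) \<and>
                  conjugate_in (affine_C n) x a))"
proof -
  interpret group "affine_C n"
    by (rule affine_C_group)
  \<comment> \<open>Every involution is conjugate to the standard element whose parameters are its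
    own cycle type. Equal types therefore lead to the same standard element, which links the two
    involutions.\<close>
  have standard: "\<exists>m ke ko l. labelled_cycle_type n x = (m, ke, ko, l) \<and> 2 * m + ke + ko + l = n \<and>
      conjugate_in (affine_C n) x (standard_elt n m ke ko l)"
    if "is_involution (affine_C n) x" for x
  proof -
    obtain \<sigma> v where x: "x = (\<sigma>, v)"
      by fastforce
    interpret self_inverse n \<sigma> v
      using is_involution_self_inverse[OF that] x by simp
    show ?thesis
      using labelled_cycle_type_eq card_classes conjugate_in_sym[OF conjugate_standard_elt] x by blast
  qed
  show ?thesis
  proof (intro conjI allI impI)
    fix x y assume xy: "is_involution (affine_C n) x" "is_involution (affine_C n) y"
    show "conjugate_in (affine_C n) x y \<longleftrightarrow> labelled_cycle_type n x = labelled_cycle_type n y"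
    proof
      assume "conjugate_in (affine_C n) x y"
      then show "labelled_cycle_type n x = labelled_cycle_type n y"
        using conjugate_labelled_cycle_type is_involution_self_inverse xy by blast
    next
      assume "labelled_cycle_type n x = labelled_cycle_type n y"
      then obtain m ke ko l where "conjugate_in (affine_C n) x (standard_elt n m ke ko l)"
        "conjugate_in (affine_C n) y (standard_elt n m ke ko l)"
        using standard[OF xy(1)] standard[OF xy(2)] by (metis prod.inject)
      then show "conjugate_in (affine_C n) x y"
        using conjugate_in_sym conjugate_in_trans by blast
    qed
  next
    fix x assume x: "is_involution (affine_C n) x"
    \<comment> \<open>A standard element conjugate to \<open>x\<close> has the type of
      \<open>x\<close>, and its type is its parameter tuple; so \<open>x\<close> determines the
      parameters and with them the element.\<close>
    have unique: "labelled_cycle_type n x = (m, ke, ko, l)"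
      if "2 * m + ke + ko + l = n" "conjugate_in (affine_C n) x (standard_elt n m ke ko l)"
      for m ke ko l
      using conjugate_labelled_cycle_type[OF is_involution_self_inverse[OF x]
          standard_elt_self_inverse[OF that(1)] that(2)]
        labelled_cycle_type_standard_elt[OF that(1)] by simp
    show "\<exists>!a. (\<exists>m ke ko l. 2 * m + ke + ko + l = n \<and> a = standard_elt n m ke ko l) \<and>
        conjugate_in (affine_C n) x a"
      using standard[OF x] unique by (smt (verit) prod.inject)
  qed
qed

end
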